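(* Let each $f_i:\mathbb{R}^p\to\mathbb{R}$ ($i=1,\dots,n$) be coercive and differentiable with $L_{f_i}$-Lipschitz gradient ($L_{f_i}>0$), let $L_f=\max_i L_{f_i}$, and let $W$ be a mixing matrix (see context). Let $0<\epsilon\le1$ and $\alpha_k=\frac{1}{L_f(k+1)^\epsilon}$, let ${\bf x}^0\in\mathbb{R}^{n\times p}$ be arbitrary, and let $\{{\bf x}^k\}$ be the DGD sequence ${\bf x}^{k+1}=W{\bf x}^k-\alpha_k\nabla{\bf f}({\bf x}^k)$, $k=0,1,\dots$. Suppose there is a constant $B>0$ with $\|\nabla{\bf f}({\bf x}^k)\|\le B$ for all $k$. Let $\mathcal{L}_{\alpha_k}({\bf x})={\bf 1}^T{\bf f}({\bf x})+\frac{1}{2\alpha_k}\|{\bf x}\|_{I-W}^2$. Then: (a) $\{\mathcal{L}_{\alpha_k}({\bf x}^k)\}$ and $\{{\bf 1}^T{\bf f}({\bf x}^k)\}$ converge to the same limit; (b) $\lim_{k\to\infty}{\bf 1}^T\nabla{\bf f}({\bf x}^k)=0$, and any limit point of $\{{\bf x}^k\}$ is a stationary point of the consensus problem $$\min_{{\bf x}\in\mathbb{R}^{n\times p}}\ \sum_{i=1}^nf_i({\bf x}_{(i)})\quad\text{subject to } {\bf x}_{(i)}={\bf x}_{(j)}\ \ \forall(i,j)\in\mathcal{E};$$ (c) in addition, if $\{{\bf x}^k\}$ has an isolated accumulation point, then $\{{\bf x}^k\}$ converges.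
   Context: Notation. $\mathcal{G}=(\mathcal{V},\mathcal{E})$ is a connected undirected graph with $\mathcal{V}=\{1,\dots,n\}$. For ${\bf x}\in\mathbb{R}^{n\times p}$, ${\bf x}_{(i)}\in\mathbb{R}^p$ is its $i$-th row (as a column vector). $\|\cdot\|$ is the Frobenius norm, $\langle\cdot,\cdot\rangle$ the corresponding inner product, and $\|X\|_G^2=\langle X,GX\rangle$ for symmetric positive semidefinite $G\in\mathbb{R}^{n\times n}$. $I$ is the $n\times n$ identity, ${\bf 1}\in\mathbb{R}^n$ the all-ones vector. ${\bf 1}^T{\bf f}({\bf x})=\sum_{i=1}^n f_i({\bf x}_{(i)})$, and $\nabla{\bf f}({\bf x})\in\mathbb{R}^{n\times p}$ is the matrix whose $i$-th row is $\nabla f_i({\bf x}_{(i)})^T$. A function $h$ is coercive if $\|u\|\to\infty$ implies $h(u)\to+\infty$. Mixing matrix: $W=[w_{ij}]\in\mathbb{R}^{n\times n}$ such that (1) $w_{ij}=0$ if $i\ne j$ and $(i,j)\notin\mathcal{E}$, and $w_{ij}>0$ otherwise; (2) $W=W^T$; (3) $\mathrm{null}(I-W)=\mathrm{span}\{{\bf 1}\}$; (4) $I\succeq W\succ -I$. Stationary point of the consensus problem: a point ${\bf x}^*\in\mathbb{R}^{n\times p}$ that is consensual (all rows ${\bf x}^*_{(i)}$ are equal) and satisfies ${\bf 1}^T\nabla{\bf f}({\bf x}^* )=0$, i.e. $\sum_{i=1}^n\nabla f_i({\bf x}^*_{(i)})=0$. *)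

theory Defs
  imports "HOL-Analysis.Analysis"
begin

text \<open>The nodes are the elements of a finite type \<open>'n\<close>; an \<open>n \<times> p\<close> matrix has type
  \<open>real^'p^'n\<close>, its \<open>i\<close>-th row is \<open>x $ i\<close>, and \<open>norm\<close> and \<open>\<bullet>\<close> on this type are the Frobenius norm
  and inner product. An undirected graph is given by a symmetric relation that contains both
  orientations of each edge; loops are irrelevant.\<close>

definition connected_undirected_graph :: "('n::finite \<times> 'n) set \<Rightarrow> bool" where
  "connected_undirected_graph E \<longleftrightarrow> sym E \<and> (\<forall>i j. (i, j) \<in> E\<^sup>*)"

definition coercive :: "('a::real_normed_vector \<Rightarrow> real) \<Rightarrow> bool" where
  "coercive h \<longleftrightarrow> filterlim h at_top at_infinity"

text \<open>Meaningful only where \<open>h\<close> is differentiable; there the gradient exists and is unique.\<close>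

definition gradient :: "('a::euclidean_space \<Rightarrow> real) \<Rightarrow> 'a \<Rightarrow> 'a" where
  "gradient h x = (THE D. GDERIV h x :> D)"

lemma GDERIV_gradient:
  fixes h :: "'a::euclidean_space \<Rightarrow> real"
  assumes "h differentiable (at x)"
  shows "GDERIV h x :> gradient h x"
proof -
  from assms obtain h' where h': "(h has_derivative h') (at x)"
    by (auto simp: differentiable_def)
  then interpret bounded_linear h'
    by (rule has_derivative_bounded_linear)
  define d where "d = (\<Sum>b\<in>Basis. h' b *\<^sub>R b)"
  have "h' v = v \<bullet> d" for v
  proof -
    have "h' v = h' (\<Sum>b\<in>Basis. (v \<bullet> b) *\<^sub>R b)"
      by (simp add: euclidean_representation)
    also have "\<dots> = v \<bullet> d"
      by (simp add: d_def sum scaleR inner_sum_right mult.commute)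
    finally show ?thesis .
  qed
  then have "h' = (\<lambda>v. v \<bullet> d)"
    by (rule ext)
  then have D: "GDERIV h x :> d"
    unfolding gderiv_def by (rule subst) (rule h')
  have "D' = d" if "GDERIV h x :> D'" for D'
  proof -
    have "(\<lambda>v. v \<bullet> D') = (\<lambda>v. v \<bullet> d)"
      using that D unfolding gderiv_def by (rule has_derivative_unique)
    then have "\<forall>v. v \<bullet> D' = v \<bullet> d"
      by (rule fun_cong[THEN allI])
    then show ?thesis
      by (simp only: vector_eq_ldot)
  qed
  with D show ?thesis
    unfolding gradient_def by (rule theI)
qed

text \<open>Loewner order on matrices; the symmetry of the difference is part of the definition.\<close>

definition pos_semidefinite :: "real^'n^'n \<Rightarrow> bool" where
  "pos_semidefinite A \<longleftrightarrow> transpose A = A \<and> (\<forall>v. 0 \<le> v \<bullet> (A *v v))"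

definition pos_definite :: "real^'n^'n \<Rightarrow> bool" where
  "pos_definite A \<longleftrightarrow> transpose A = A \<and> (\<forall>v. v \<noteq> 0 \<longrightarrow> 0 < v \<bullet> (A *v v))"

definition loewner_le :: "real^'n^'n \<Rightarrow> real^'n^'n \<Rightarrow> bool" where
  "loewner_le A B \<longleftrightarrow> pos_semidefinite (B - A)"

definition loewner_less :: "real^'n^'n \<Rightarrow> real^'n^'n \<Rightarrow> bool" where
  "loewner_less A B \<longleftrightarrow> pos_definite (B - A)"

definition mixing_matrix :: "('n::finite \<times> 'n) set \<Rightarrow> real^'n^'n \<Rightarrow> bool" where
  "mixing_matrix E W \<longleftrightarrow>
     (\<forall>i j. if i \<noteq> j \<and> (i, j) \<notin> E then W $ i $ j = 0 else W $ i $ j > 0) \<and>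
     transpose W = W \<and>
     {v. (mat 1 - W) *v v = 0} = span {\<chi> i. 1} \<and>
     loewner_le W (mat 1) \<and> loewner_less (- mat 1) W"

definition weighted_norm_sq :: "real^'n^'n \<Rightarrow> real^'p^'n \<Rightarrow> real" where
  "weighted_norm_sq G X = X \<bullet> (G ** X)"

definition total_obj :: "('n \<Rightarrow> real^'p \<Rightarrow> real) \<Rightarrow> real^'p^'n::finite \<Rightarrow> real" where
  "total_obj f x = (\<Sum>i\<in>UNIV. f i (x $ i))"

definition stacked_grad :: "('n \<Rightarrow> real^'p \<Rightarrow> real) \<Rightarrow> real^'p^'n::finite \<Rightarrow> real^'p^'n" where
  "stacked_grad f x = (\<chi> i. gradient (f i) (x $ i))"

definition lyapunov ::
    "real^'n^'n \<Rightarrow> ('n \<Rightarrow> real^'p \<Rightarrow> real) \<Rightarrow> real \<Rightarrow> real^'p^'n::finite \<Rightarrow> real" where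
  "lyapunov W f a x = total_obj f x + 1 / (2 * a) * weighted_norm_sq (mat 1 - W) x"

definition consensus_stationary :: "('n \<Rightarrow> real^'p \<Rightarrow> real) \<Rightarrow> real^'p^'n::finite \<Rightarrow> bool" where
  "consensus_stationary f x \<longleftrightarrow>
     (\<forall>i j. x $ i = x $ j) \<and> (\<Sum>i\<in>UNIV. stacked_grad f x $ i) = 0"

text \<open>Limit points of a sequence, i.e. limits of its subsequences; a constant tail counts.\<close>

definition seq_limit_points :: "(nat \<Rightarrow> 'a::topological_space) \<Rightarrow> 'a set" where
  "seq_limit_points x = {z. \<exists>r. strict_mono r \<and> (x \<circ> r) \<longlonglongrightarrow> z}"

end

theory Submission
  imports Defs
begin

text \<open>
  On the matrix space write \<open>T X = W ** X\<close> and let \<open>P\<close> replace each row by the average of all rows.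
  Then \<open>T\<close> is self-adjoint with spectrum in the half-open interval from \<open>-1\<close> (excluded) to \<open>1\<close>,
  and \<open>P\<close> is the orthogonal projection onto its fixed space, the consensual matrices. The argument
  uses only these two properties, a Lipschitz gradient \<open>G\<close> of an objective \<open>F\<close> that is bounded
  below, the bound on \<open>G\<close> along the iterates, and steps \<open>\<alpha>\<close> that decrease to \<open>0\<close>, have a divergent
  sum and satisfy \<open>\<alpha> k / \<alpha> (k + 1) \<longlonglongrightarrow> 1\<close>. It is carried out in this generality and then specialised.

  \<^item> \<^emph>\<open>Deviation.\<close> On the kernel of \<open>P\<close> the operator \<open>T\<close> contracts by a factor \<open>\<rho> < 1\<close>, so the
    deviation \<open>x k - P (x k)\<close> obeys an affine recursion with inhomogeneity of order \<open>\<alpha> k\<close>. As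
    consecutive steps are almost equal, the deviation, and with it \<open>x (k + 1) - x k\<close>, is of order
    \<open>\<alpha> k\<close> (\<open>deviation_bound\<close>, \<open>step_bound\<close>).

  \<^item> \<^emph>\<open>Descent.\<close> An iteration is a gradient step of length \<open>\<alpha> k\<close> for
    \<open>F v + 1 / (2 * \<alpha> k) * (v \<bullet> (v - T v))\<close>, and because \<open>I + T\<close> is positive definite it decreases this
    function by a multiple of \<open>\<parallel>x (k + 1) - x k\<parallel>\<^sup>2 / \<alpha> k\<close>. Passing from \<open>\<alpha> k\<close> to \<open>\<alpha> (k + 1)\<close>
    increases the penalty, but only by a multiple of \<open>\<alpha> k - \<alpha> (k + 1)\<close>, because the quadratic form
    is of order \<open>\<alpha>\<^sup>2\<close> at the iterates. These increases telescope. Hence the Lyapunov values converge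
    and the decreases are summable (\<open>eventually_V_descent\<close>, \<open>V_convergent\<close>, \<open>steps_summable\<close>). The
    penalty itself is of order \<open>\<alpha> k\<close>, so \<open>F (x k)\<close> has the same limit.

  \<^item> \<^emph>\<open>Stationarity.\<close> Since \<open>P\<close> annihilates \<open>T v - v\<close>, it maps \<open>x (k + 1) - x k\<close> to
    \<open>- \<alpha> k *\<^sub>R P (G (x k))\<close>, so \<open>\<Sum>k. \<alpha> k * \<parallel>P (G (x k))\<parallel>\<^sup>2\<close> is finite. As \<open>P (G (x k))\<close> changes by
    at most a multiple of \<open>\<alpha> k\<close> per iteration and the steps have infinite sum, it tends to \<open>0\<close>
    (\<open>slowly_varying_tendsto_0\<close>). Limit points are consensual by the deviation bound and satisfy
    \<open>P (G z) = 0\<close> by continuity.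

  \<^item> \<^emph>\<open>Convergence.\<close> The increments tend to \<open>0\<close>. A sequence with this property that does not
    converge to one of its limit points \<open>z\<close> has further limit points in arbitrarily small annuli
    around \<open>z\<close>, so \<open>z\<close> is not isolated (\<open>isolated_limit_point_imp_convergent\<close>).
\<close>

section \<open>Real sequences\<close>

text \<open>For ratios \<open>r k = (deviation at k) / \<alpha> k\<close>: the level \<open>D / (1 - q)\<close> is the fixed point of the
  recursion, so any level above it that bounds one term bounds all later ones.\<close>
lemma affine_recursion_bounded:
  fixes r :: "nat \<Rightarrow> real"
  assumes "eventually (\<lambda>k. r (Suc k) \<le> q * r k + D) sequentially" and "0 \<le> q" "q < 1"
  obtains C where "\<And>k. r k \<le> C"
proof -
  from assms(1) obtain N where N: "\<And>k. k \<ge> N \<Longrightarrow> r (Suc k) \<le> q * r k + D"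
    by (auto simp: eventually_sequentially)
  define C where "C = max (Max (r ` {..N})) (D / (1 - q))"
  have "D / (1 - q) \<le> C"
    by (simp add: C_def)
  then have C: "q * C + D \<le> C"
    using \<open>q < 1\<close> by (simp add: field_simps)
  have "r k \<le> C" for k
  proof (cases "k \<le> N")
    case True
    then have "r k \<le> Max (r ` {..N})"
      by (intro Max_ge) auto
    then show ?thesis
      by (simp add: C_def)
  next
    case False
    have "r N \<le> Max (r ` {..N})"
      by (intro Max_ge) auto
    then have base: "r N \<le> C"
      unfolding C_def by linarith
    from False have "N \<le> k"
      by simp
    then show ?thesis
    proof (induction k rule: dec_induct)
      case base
      show ?case by fact
    next
      case (step k)
      have "r (Suc k) \<le> q * r k + D"
        using N step.hyps by simp
      also have "\<dots> \<le> q * C + D"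
        using step.IH \<open>0 \<le> q\<close> by (simp add: mult_left_mono)
      finally show ?case
        using C by simp
    qed
  qed
  then show ?thesis
    by (rule that)
qed

text \<open>The increments of \<open>a ^ 3\<close> are at most those of \<open>a\<close> times a quadratic expression in \<open>a\<close>, that
  is, of order \<open>\<alpha> * a\<^sup>2\<close>, so they are absolutely summable and \<open>a\<close> converges. A nonzero limit would
  make \<open>\<alpha>\<close> itself summable. The ratio hypothesis lets \<open>\<alpha> k\<close> be paired with \<open>a (Suc k)\<close>.\<close>
lemma slowly_varying_tendsto_0:
  fixes a \<alpha> :: "nat \<Rightarrow> real"
  assumes a: "\<And>k. 0 \<le> a k"
    and pos: "\<And>k. 0 < \<alpha> k"
    and ratio: "eventually (\<lambda>k. \<alpha> k \<le> c * \<alpha> (Suc k)) sequentially"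
    and div: "\<not> summable \<alpha>"
    and sum: "summable (\<lambda>k. \<alpha> k * (a k)\<^sup>2)"
    and var: "\<And>k. \<bar>a (Suc k) - a k\<bar> \<le> C * \<alpha> k"
  shows "a \<longlonglongrightarrow> 0"
proof -
  have "0 \<le> C * \<alpha> 0"
    using var[of 0] by linarith
  then have C: "0 \<le> C"
    using pos[of 0] by (simp add: zero_le_mult_iff)
  have "summable (\<lambda>k. 2 * C * (\<alpha> k * (a k)\<^sup>2) + 2 * C * c * (\<alpha> (Suc k) * (a (Suc k))\<^sup>2))"
    using sum summable_Suc_iff[of "\<lambda>k. \<alpha> k * (a k)\<^sup>2"] by (intro summable_add summable_mult) auto
  moreover have "eventually (\<lambda>k. norm (a (Suc k) ^ 3 - a k ^ 3)
      \<le> 2 * C * (\<alpha> k * (a k)\<^sup>2) + 2 * C * c * (\<alpha> (Suc k) * (a (Suc k))\<^sup>2)) sequentially"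
    using ratio
  proof eventually_elim
    case (elim k)
    let ?u = "a (Suc k)" and ?v = "a k"
    have "?u ^ 3 - ?v ^ 3 = (?u - ?v) * (?u\<^sup>2 + ?u * ?v + ?v\<^sup>2)"
      by (simp add: power2_eq_square power3_eq_cube algebra_simps)
    moreover have "0 \<le> ?u\<^sup>2 + ?u * ?v + ?v\<^sup>2"
      using a by simp
    moreover have "?u\<^sup>2 + ?u * ?v + ?v\<^sup>2 \<le> 2 * ?u\<^sup>2 + 2 * ?v\<^sup>2"
      using sum_squares_bound[of ?u ?v] zero_le_power2[of ?u] zero_le_power2[of ?v] by linarith
    ultimately have "norm (?u ^ 3 - ?v ^ 3) \<le> (C * \<alpha> k) * (2 * ?u\<^sup>2 + 2 * ?v\<^sup>2)"
      using var[of k] by (auto simp: abs_mult intro!: mult_mono)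
    also have "\<dots> = 2 * C * (\<alpha> k * ?v\<^sup>2) + 2 * C * (\<alpha> k * ?u\<^sup>2)"
      by (simp add: algebra_simps)
    also have "2 * C * (\<alpha> k * ?u\<^sup>2) \<le> 2 * C * (c * \<alpha> (Suc k) * ?u\<^sup>2)"
      using elim C by (intro mult_left_mono mult_right_mono) auto
    finally show ?case
      by (simp add: algebra_simps)
  qed
  ultimately have "summable (\<lambda>k. a (Suc k) ^ 3 - a k ^ 3)"
    by (rule summable_comparison_test_ev[rotated])
  then have "convergent (\<lambda>n. \<Sum>k<n. a (Suc k) ^ 3 - a k ^ 3)"
    by (simp add: summable_iff_convergent)
  then have "convergent (\<lambda>n. a n ^ 3 - a 0 ^ 3)"
    by (simp only: sum_lessThan_telescope[of "\<lambda>k. a k ^ 3"])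
  then have "convergent (\<lambda>n. a n ^ 3)"
    by (simp add: convergent_diff_const_right_iff)
  then obtain l where l: "(\<lambda>n. a n ^ 3) \<longlonglongrightarrow> l"
    by (auto simp: convergent_def)
  then have "(\<lambda>n. root 3 (a n ^ 3)) \<longlonglongrightarrow> root 3 l"
    by (rule tendsto_real_root)
  then have lim: "a \<longlonglongrightarrow> root 3 l"
    by (simp add: odd_real_root_power_cancel)
  have "root 3 l = 0"
  proof (rule ccontr)
    assume "root 3 l \<noteq> 0"
    define m where "m = (root 3 l)\<^sup>2 / 2"
    have m: "0 < m" "m < (root 3 l)\<^sup>2"
      using \<open>root 3 l \<noteq> 0\<close> by (auto simp: m_def)
    have "(\<lambda>k. (a k)\<^sup>2) \<longlonglongrightarrow> (root 3 l)\<^sup>2"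
      using lim by (intro tendsto_intros)
    then have "eventually (\<lambda>k. m < (a k)\<^sup>2) sequentially"
      using m by (intro order_tendstoD)
    then have "eventually (\<lambda>k. norm (\<alpha> k) \<le> \<alpha> k * (a k)\<^sup>2 / m) sequentially"
      by eventually_elim (use m pos in \<open>simp add: field_simps less_imp_le\<close>)
    moreover have "summable (\<lambda>k. \<alpha> k * (a k)\<^sup>2 / m)"
      using sum by (rule summable_divide)
    ultimately have "summable \<alpha>"
      by (rule summable_comparison_test_ev)
    with div show False ..
  qed
  with lim show ?thesis by simp
qed

section \<open>Sequences with vanishing increments\<close>

text \<open>A sequence that returns to \<open>z\<close> infinitely often and also leaves a fixed ball around \<open>z\<close>
  infinitely often cannot, with small increments, jump over the annulus between radii \<open>e / 2\<close> and
  \<open>e\<close>; by compactness it has a limit point there.\<close>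
lemma isolated_limit_point_imp_convergent:
  fixes x :: "nat \<Rightarrow> 'a::heine_borel"
  assumes steps: "(\<lambda>k. dist (x (Suc k)) (x k)) \<longlonglongrightarrow> 0"
    and z: "z isolated_in seq_limit_points x"
  shows "x \<longlonglongrightarrow> z"
proof (rule ccontr)
  assume "\<not> x \<longlonglongrightarrow> z"
  then obtain e1 where e1: "0 < e1" "\<And>N. \<exists>k\<ge>N. e1 \<le> dist (x k) z"
    unfolding lim_sequentially by (meson not_le)
  obtain r where r: "strict_mono r" "(x \<circ> r) \<longlonglongrightarrow> z"
    using z by (auto simp: isolated_in_def seq_limit_points_def)
  obtain U where U: "open U" "U \<inter> seq_limit_points x = {z}"
    using z by (auto simp: isolated_in_def)
  then obtain e2 where e2: "0 < e2" "cball z e2 \<subseteq> U"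
    using open_contains_cball[of U] by blast
  define e where "e = min e1 e2"
  have e: "0 < e" "e \<le> e1" "e \<le> e2"
    using e1 e2 by (auto simp: e_def)
  define A where "A = cball z e - ball z (e / 2)"
  have "compact A"
    unfolding A_def by (intro compact_diff) auto
  have inA: "\<exists>k\<ge>N. x k \<in> A" for N
  proof -
    have "eventually (\<lambda>k. dist (x (Suc k)) (x k) < e / 2) sequentially"
      using steps e by (intro order_tendstoD) auto
    then obtain N1 where N1: "\<And>k. k \<ge> N1 \<Longrightarrow> dist (x (Suc k)) (x k) < e / 2"
      by (auto simp: eventually_sequentially)
    have "eventually (\<lambda>j. dist ((x \<circ> r) j) z < e / 2) sequentially"
      using r(2) e by (intro tendstoD) (simp_all only: half_gt_zero)
    then obtain J where J: "\<And>j. j \<ge> J \<Longrightarrow> dist (x (r j)) z < e / 2"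
      by (auto simp: eventually_sequentially)
    define m where "m = r (max J (max N N1))"
    have m: "dist (x m) z < e / 2"
      unfolding m_def by (rule J) simp
    have "max J (max N N1) \<le> m"
      unfolding m_def by (rule seq_suble[OF r(1)])
    then have mN: "N \<le> m" "N1 \<le> m"
      by auto
    obtain k0 where k0: "k0 \<ge> m" "e1 \<le> dist (x k0) z"
      using e1(2) by blast
    \<comment> \<open>the first time after \<open>m\<close> at which the sequence is outside the inner ball\<close>
    define k where "k = (LEAST k. k \<ge> m \<and> e / 2 \<le> dist (x k) z)"
    have ex: "k0 \<ge> m \<and> e / 2 \<le> dist (x k0) z"
      using k0 e by auto
    have k: "k \<ge> m" "e / 2 \<le> dist (x k) z"
      using LeastI[where P = "\<lambda>k. k \<ge> m \<and> e / 2 \<le> dist (x k) z", OF ex] by (auto simp: k_def)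
    have "k \<noteq> m"
      using k m by auto
    then obtain j where j: "k = Suc j" "m \<le> j"
      using k(1) by (cases k) auto
    then have "\<not> (m \<le> j \<and> e / 2 \<le> dist (x j) z)"
      unfolding k_def using not_less_Least[of j "\<lambda>k. k \<ge> m \<and> e / 2 \<le> dist (x k) z"]
      by (simp add: k_def)
    then have "dist (x j) z < e / 2"
      using j by auto
    moreover have "dist (x k) (x j) < e / 2"
      using N1 j mN by simp
    ultimately have "dist (x k) z < e"
      using dist_triangle[of "x k" z "x j"] by linarith
    then have "x k \<in> A"
      using k(2) by (simp add: A_def dist_commute)
    then show ?thesis
      using k(1) mN by (intro exI[of _ k]) auto
  qed
  have "infinite {k. x k \<in> A}"
    unfolding infinite_nat_iff_unbounded_le using inA by auto
  from infinite_enumerate[OF this] obtain s :: "nat \<Rightarrow> nat"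
    where s: "strict_mono s" "\<forall>j. s j \<in> {k. x k \<in> A}"
    by auto
  have "\<forall>j. (x \<circ> s) j \<in> A"
    using s(2) by simp
  then obtain w and t :: "nat \<Rightarrow> nat" where
    w: "w \<in> A" "strict_mono t" "((x \<circ> s) \<circ> t) \<longlonglongrightarrow> w"
    using seq_compactE[OF compact_imp_seq_compact[OF \<open>compact A\<close>]] by metis
  have "strict_mono (s \<circ> t)"
    using s(1) w(2) by (rule strict_mono_o)
  then have "w \<in> seq_limit_points x"
    using w(3) unfolding seq_limit_points_def by (auto simp: o_assoc)
  moreover have "w \<in> U"
    using w(1) e e2 by (auto simp: A_def)
  ultimately have "w = z"
    using U by auto
  with w(1) e show False
    by (simp add: A_def)
qed

section \<open>Functions with Lipschitz gradient, coercive functions\<close>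

text \<open>The mean value theorem along the segment gives the descent lemma with constant \<open>M\<close> in place
  of the sharp \<open>M / 2\<close>; as the steps tend to \<open>0\<close>, the value of the constant is immaterial.\<close>
lemma gradient_mean_value_bound:
  fixes F :: "'a::euclidean_space \<Rightarrow> real"
  assumes F: "\<And>v. GDERIV F v :> G v" and lip: "M-lipschitz_on UNIV G"
  shows "F w \<le> F v + G v \<bullet> (w - v) + M * (norm (w - v))\<^sup>2"
proof -
  define \<phi> where "\<phi> t = F (v + t *\<^sub>R (w - v))" for t
  have "(\<phi> has_real_derivative (w - v) \<bullet> G (v + t *\<^sub>R (w - v))) (at t)" for t
  proof -
    have "(F has_derivative (\<lambda>h. h \<bullet> G (v + t *\<^sub>R (w - v)))) (at (v + t *\<^sub>R (w - v)))"
      using F by (simp add: gderiv_def)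
    moreover have "((\<lambda>t. v + t *\<^sub>R (w - v)) has_derivative (\<lambda>h. h *\<^sub>R (w - v))) (at t)"
      by (auto intro!: derivative_eq_intros)
    ultimately have "(\<phi> has_derivative (\<lambda>h. (h *\<^sub>R (w - v)) \<bullet> G (v + t *\<^sub>R (w - v)))) (at t)"
      unfolding \<phi>_def by (rule has_derivative_compose[rotated])
    then show ?thesis
      by (simp add: has_field_derivative_def mult_commute_abs)
  qed
  then obtain t where t: "0 < t" "t < 1" "\<phi> 1 - \<phi> 0 = (1 - 0) * ((w - v) \<bullet> G (v + t *\<^sub>R (w - v)))"
    using MVT2[of 0 1 \<phi> "\<lambda>t. (w - v) \<bullet> G (v + t *\<^sub>R (w - v))"] by auto
  have M: "0 \<le> M"
    using lip by (rule lipschitz_on_nonneg)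
  have "(w - v) \<bullet> (G (v + t *\<^sub>R (w - v)) - G v) \<le> norm (w - v) * norm (G (v + t *\<^sub>R (w - v)) - G v)"
    by (rule norm_cauchy_schwarz)
  also have "norm (G (v + t *\<^sub>R (w - v)) - G v) \<le> M * norm (t *\<^sub>R (w - v))"
    using lipschitz_onD[OF lip, of "v + t *\<^sub>R (w - v)" v] by (simp add: dist_norm)
  also have "\<dots> \<le> M * norm (w - v)"
    using t M by (intro mult_left_mono) (auto simp: mult_left_le_one_le)
  finally have "(w - v) \<bullet> (G (v + t *\<^sub>R (w - v)) - G v) \<le> norm (w - v) * (M * norm (w - v))"
    by (simp add: mult_left_mono)
  then have "(w - v) \<bullet> (G (v + t *\<^sub>R (w - v)) - G v) \<le> M * (norm (w - v))\<^sup>2"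
    by (simp add: power2_eq_square mult.left_commute)
  moreover have "F w - F v = (w - v) \<bullet> G (v + t *\<^sub>R (w - v))"
    using t(3) by (simp add: \<phi>_def)
  ultimately show ?thesis
    by (simp add: inner_diff_right inner_commute)
qed

lemma coercive_bounded_below:
  fixes h :: "'a::euclidean_space \<Rightarrow> real"
  assumes "coercive h" "continuous_on UNIV h"
  obtains c where "\<And>u. c \<le> h u"
proof -
  have "eventually (\<lambda>u. 0 \<le> h u) at_infinity"
    using assms(1) by (simp add: coercive_def filterlim_at_top)
  then obtain R where R: "\<And>u. R \<le> norm u \<Longrightarrow> 0 \<le> h u"
    by (auto simp: eventually_at_infinity)
  have "bounded (h ` cball 0 R)"
    using assms(2) by (intro compact_imp_bounded compact_continuous_image)
      (auto intro: continuous_on_subset)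
  then obtain b where b: "\<And>u. u \<in> cball 0 R \<Longrightarrow> \<bar>h u\<bar> \<le> b"
    unfolding bounded_iff by (metis image_eqI real_norm_def)
  have "min 0 (- b) \<le> h u" for u
  proof (cases "R \<le> norm u")
    case True
    then show ?thesis using R[of u] by linarith
  next
    case False
    then show ?thesis using b[of u] by (auto simp: min_le_iff_disj)
  qed
  then show ?thesis by (rule that)
qed

section \<open>Averaging operators\<close>

text \<open>A self-adjoint \<open>T\<close> with \<open>-I < T \<le> I\<close> together with the orthogonal projection \<open>P\<close> onto its
  fixed space.\<close>
locale averaging_operator =
  fixes T P :: "'a::euclidean_space \<Rightarrow> 'a"
  assumes linear_T: "linear T" and linear_P: "linear P"
    and T_adjoint: "\<And>u v. u \<bullet> T v = T u \<bullet> v"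
    and P_adjoint: "\<And>u v. u \<bullet> P v = P u \<bullet> v"
    and T_le: "\<And>v. 0 \<le> v \<bullet> (v - T v)"
    and T_gt: "\<And>v. v \<noteq> 0 \<Longrightarrow> 0 < v \<bullet> (v + T v)"
    and T_P: "\<And>v. T (P v) = P v"
    and P_fixed: "\<And>v. T v = v \<Longrightarrow> P v = v"
begin

lemmas T_simps = linear_add[OF linear_T] linear_diff[OF linear_T] linear_scale[OF linear_T]
  linear_0[OF linear_T]
lemmas P_simps = linear_add[OF linear_P] linear_diff[OF linear_P] linear_scale[OF linear_P]
  linear_0[OF linear_P]

lemma P_T: "P (T v) = P v"
proof -
  have "u \<bullet> P (T v) = u \<bullet> P v" for u
    by (metis P_adjoint T_adjoint T_P)
  then show ?thesis
    by (metis vector_eq_ldot)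
qed

lemma P_P: "P (P v) = P v"
  by (rule P_fixed) (rule T_P)

lemma continuous_on_T [continuous_intros]:
  fixes S :: "'a set" and g :: "'a \<Rightarrow> 'a"
  shows "continuous_on S g \<Longrightarrow> continuous_on S (\<lambda>v. T (g v))"
  using linear_continuous_on_compose[of S g T] linear_T by blast

lemma continuous_on_P [continuous_intros]:
  fixes S :: "'a set" and g :: "'a \<Rightarrow> 'a"
  shows "continuous_on S g \<Longrightarrow> continuous_on S (\<lambda>v. P (g v))"
  using linear_continuous_on_compose[of S g P] linear_P by blast

text \<open>With \<open>A = I - T\<close> and \<open>B = I + T\<close> the claim is \<open>0 < v \<bullet> (A B v)\<close>. Since \<open>A\<close> and \<open>B\<close> commute
  and \<open>A + B = 2 I\<close>, one has \<open>2 A B = A B A + B A B\<close>, and \<open>v \<bullet> (A B A v) = A v \<bullet> (B (A v))\<close> is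
  positive as \<open>A v \<noteq> 0\<close>, while \<open>v \<bullet> (B A B v)\<close> is nonnegative. This avoids diagonalising \<open>T\<close>.\<close>
lemma norm_T_less:
  assumes "P v = 0" "v \<noteq> 0"
  shows "norm (T v) < norm v"
proof -
  let ?a = "v - T v" and ?b = "v + T v"
  have "T v \<noteq> v"
    using P_fixed[of v] assms by auto
  then have "0 < ?a \<bullet> (?a + T ?a)"
    by (intro T_gt) simp
  moreover have "0 \<le> ?b \<bullet> (?b - T ?b)"
    by (rule T_le)
  moreover have "?a \<bullet> (?a + T ?a) + ?b \<bullet> (?b - T ?b) = 2 * (v \<bullet> v - T v \<bullet> T v)"
    using T_adjoint[of v "T v"] T_adjoint[of v "T (T v)"] T_adjoint[of v v]
    by (simp add: T_simps algebra_simps inner_commute)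
  ultimately have "0 < 2 * (v \<bullet> v - T v \<bullet> T v)"
    by (metis add_pos_nonneg)
  then have "(norm (T v))\<^sup>2 < (norm v)\<^sup>2"
    unfolding power2_norm_eq_inner by simp
  then show ?thesis
    by (rule power_less_imp_less_base) simp
qed

text \<open>Compactness of the unit sphere turns the strict inequality into a uniform factor. The sphere
  in the kernel of \<open>P\<close> is empty when \<open>T\<close> is the identity, whence the case distinction.\<close>
lemma T_contraction:
  obtains \<rho> where "0 \<le> \<rho>" "\<rho> < 1" "\<And>v. P v = 0 \<Longrightarrow> norm (T v) \<le> \<rho> * norm v"
proof -
  define S where "S = sphere 0 1 \<inter> {v. P v = 0}"
  have "closed {v. P v = 0}"
    by (intro closed_Collect_eq continuous_intros)
  then have "compact S"
    unfolding S_def by (intro compact_Int_closed) auto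
  have "\<exists>\<rho>. 0 \<le> \<rho> \<and> \<rho> < 1 \<and> (\<forall>v\<in>S. norm (T v) \<le> \<rho>)"
  proof (cases "S = {}")
    case True
    then show ?thesis by (intro exI[of _ 0]) auto
  next
    case False
    have "continuous_on S (\<lambda>v. norm (T v))"
      by (intro continuous_intros)
    with \<open>compact S\<close> False obtain u where u: "u \<in> S" "\<forall>v\<in>S. norm (T v) \<le> norm (T u)"
      using continuous_attains_sup by blast
    then have "norm (T u) < norm u"
      by (intro norm_T_less) (auto simp: S_def)
    with u show ?thesis
      by (intro exI[of _ "norm (T u)"]) (auto simp: S_def)
  qed
  then obtain \<rho> where \<rho>: "0 \<le> \<rho>" "\<rho> < 1" "\<And>v. v \<in> S \<Longrightarrow> norm (T v) \<le> \<rho>"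
    by auto
  have "norm (T v) \<le> \<rho> * norm v" if "P v = 0" for v
  proof (cases "v = 0")
    case False
    then have "v /\<^sub>R norm v \<in> S"
      using that by (simp add: S_def P_simps)
    from \<rho>(3)[OF this] False show ?thesis
      by (simp add: T_simps field_simps)
  qed (simp add: T_simps)
  with \<rho> that show ?thesis by blast
qed

lemma id_plus_T_bounded_below:
  obtains \<mu> where "0 < \<mu>" "\<And>v. \<mu> * (norm v)\<^sup>2 \<le> v \<bullet> (v + T v)"
proof -
  have ne: "sphere (0::'a) 1 \<noteq> {}"
    by simp
  have "continuous_on (sphere 0 1) (\<lambda>v. v \<bullet> (v + T v))"
    by (intro continuous_intros)
  with ne obtain u where u: "u \<in> sphere 0 1" "\<forall>v\<in>sphere 0 1. u \<bullet> (u + T u) \<le> v \<bullet> (v + T v)"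
    using continuous_attains_inf[of "sphere (0::'a) 1"] by (metis compact_sphere)
  have "0 < u \<bullet> (u + T u)"
    using u by (intro T_gt) auto
  moreover have "u \<bullet> (u + T u) * (norm v)\<^sup>2 \<le> v \<bullet> (v + T v)" for v
  proof (cases "v = 0")
    case False
    then have "v /\<^sub>R norm v \<in> sphere 0 1"
      by simp
    with u(2) have "u \<bullet> (u + T u) \<le> (v /\<^sub>R norm v) \<bullet> (v /\<^sub>R norm v + T (v /\<^sub>R norm v))"
      by blast
    also have "\<dots> = (v \<bullet> (v + T v)) / (norm v)\<^sup>2"
      by (simp add: T_simps inner_add_right power2_eq_square field_simps)
        (simp add: add_divide_distrib)
    finally show ?thesis
      using False by (simp add: field_simps)
  qed (simp add: T_simps)
  ultimately show ?thesis by (rule that)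
qed

text \<open>The form \<open>v \<bullet> (v - T v)\<close> depends only on the component orthogonal to the fixed space, and
  \<open>I - T \<le> 2 I\<close>.\<close>
lemma quadratic_deviation_bound: "v \<bullet> (v - T v) \<le> 2 * (norm (v - P v))\<^sup>2"
proof -
  define d where "d = v - P v"
  have "v \<bullet> (v - T v) = d \<bullet> (d - T d)"
    using T_adjoint[of "P v" v] T_adjoint[of "P v" "P v"]
    by (simp add: d_def T_simps T_P inner_simps)
  also have "\<dots> = 2 * (d \<bullet> d) - d \<bullet> (d + T d)"
    by (simp add: inner_simps)
  also have "\<dots> \<le> 2 * (d \<bullet> d)"
    using T_gt[of d] by (cases "d = 0") auto
  finally show ?thesis
    by (simp add: d_def power2_norm_eq_inner)
qed

end

section \<open>Gradient descent with an averaging operator\<close>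
locale averaged_gradient_descent = averaging_operator T P
  for T P :: "'a::euclidean_space \<Rightarrow> 'a" +
  fixes F :: "'a \<Rightarrow> real" and G :: "'a \<Rightarrow> 'a" and M B c :: real
    and \<alpha> :: "nat \<Rightarrow> real" and x :: "nat \<Rightarrow> 'a"
  assumes F_gradient: "\<And>v. GDERIV F v :> G v"
    and G_lipschitz: "M-lipschitz_on UNIV G"
    and F_bounded_below: "\<And>v. c \<le> F v"
    and \<alpha>_pos: "\<And>k. 0 < \<alpha> k"
    and \<alpha>_decreasing: "\<And>k. \<alpha> (Suc k) \<le> \<alpha> k"
    and \<alpha>_tendsto_0: "\<alpha> \<longlonglongrightarrow> 0"
    and \<alpha>_ratio: "(\<lambda>k. \<alpha> k / \<alpha> (Suc k)) \<longlonglongrightarrow> 1"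
    and \<alpha>_not_summable: "\<not> summable \<alpha>"
    and x_Suc: "\<And>k. x (Suc k) = T (x k) - \<alpha> k *\<^sub>R G (x k)"
    and G_bounded: "\<And>k. norm (G (x k)) \<le> B"
begin

lemma M_nonneg: "0 \<le> M"
  using G_lipschitz by (rule lipschitz_on_nonneg)

lemma B_nonneg: "0 \<le> B"
  using G_bounded[of 0] norm_ge_zero[of "G (x 0)"] by linarith

lemma \<alpha>_ratio_le_2: "eventually (\<lambda>k. \<alpha> k / \<alpha> (Suc k) < 2) sequentially"
  using \<alpha>_ratio by (rule order_tendstoD) simp

text \<open>For \<open>d k = x k - P (x k)\<close> the iteration gives \<open>d (k + 1) = T (d k) - \<alpha> k *\<^sub>R (G - P G)\<close>, hence
  after division by \<open>\<alpha> (k + 1)\<close> an affine recursion with factor \<open>\<rho> * \<alpha> k / \<alpha> (k + 1)\<close>, which is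
  eventually below any number above \<open>\<rho>\<close>.\<close>
lemma deviation_bound:
  obtains C where "0 \<le> C" "\<And>k. norm (x k - P (x k)) \<le> C * \<alpha> k"
proof -
  obtain K where K: "K > 0" "\<And>v. norm (P v) \<le> K * norm v"
    using linear_bounded_pos[OF linear_P] by blast
  obtain \<rho> where \<rho>: "0 \<le> \<rho>" "\<rho> < 1" "\<And>v. P v = 0 \<Longrightarrow> norm (T v) \<le> \<rho> * norm v"
    using T_contraction by blast
  define r where "r k = norm (x k - P (x k)) / \<alpha> k" for k
  define E where "E = (1 + K) * B"
  have E: "0 \<le> E"
    using K B_nonneg by (simp add: E_def)
  have r_nonneg: "0 \<le> r k" for k
    using \<alpha>_pos[of k] by (simp add: r_def)
  have rec: "r (Suc k) \<le> \<alpha> k / \<alpha> (Suc k) * (\<rho> * r k + E)" for k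
  proof -
    let ?d = "x k - P (x k)" and ?g = "G (x k)"
    have "x (Suc k) - P (x (Suc k)) = T ?d - \<alpha> k *\<^sub>R (?g - P ?g)"
      by (simp add: x_Suc P_simps T_simps P_T T_P algebra_simps)
    then have "norm (x (Suc k) - P (x (Suc k))) \<le> norm (T ?d) + \<alpha> k * norm (?g - P ?g)"
      using norm_triangle_ineq4[of "T ?d" "\<alpha> k *\<^sub>R (?g - P ?g)"] \<alpha>_pos[of k] by simp
    also have "norm (T ?d) \<le> \<rho> * norm ?d"
      by (rule \<rho>) (simp add: P_simps P_P)
    also have "norm (?g - P ?g) \<le> E"
    proof -
      have "norm (?g - P ?g) \<le> norm ?g + K * norm ?g"
        using norm_triangle_ineq4[of ?g "P ?g"] K(2)[of ?g] by linarith
      also have "\<dots> = (1 + K) * norm ?g"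
        by (simp add: algebra_simps)
      also have "\<dots> \<le> E"
        unfolding E_def using K(1) G_bounded by (intro mult_left_mono) auto
      finally show ?thesis .
    qed
    also have "norm ?d = \<alpha> k * r k"
      using \<alpha>_pos[of k] by (simp add: r_def)
    finally have "norm (x (Suc k) - P (x (Suc k))) \<le> \<alpha> k * (\<rho> * r k + E)"
      using \<alpha>_pos[of k] by (simp add: algebra_simps mult_left_mono)
    then show ?thesis
      using \<alpha>_pos[of "Suc k"] by (simp add: r_def divide_right_mono)
  qed
  define q where "q = (1 + \<rho>) / 2"
  have q: "0 \<le> q" "q < 1" "\<rho> < q"
    using \<rho> by (auto simp: q_def)
  have "(\<lambda>k. \<alpha> k / \<alpha> (Suc k) * \<rho>) \<longlonglongrightarrow> 1 * \<rho>"
    using \<alpha>_ratio by (intro tendsto_intros)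
  then have "eventually (\<lambda>k. \<alpha> k / \<alpha> (Suc k) * \<rho> < q) sequentially"
    using q by (intro order_tendstoD) auto
  then have "eventually (\<lambda>k. r (Suc k) \<le> q * r k + 2 * E) sequentially"
    using \<alpha>_ratio_le_2
  proof eventually_elim
    case (elim k)
    have "(\<alpha> k / \<alpha> (Suc k) * \<rho>) * r k \<le> q * r k"
      using elim r_nonneg by (intro mult_right_mono) auto
    moreover have "\<alpha> k / \<alpha> (Suc k) * E \<le> 2 * E"
      using elim E by (intro mult_right_mono) auto
    ultimately show ?case
      using rec[of k] by (simp only: distrib_left mult.assoc)
  qed
  then obtain C where C: "\<And>k. r k \<le> C"
    using affine_recursion_bounded q by blast
  have "0 \<le> C"
    using C[of 0] r_nonneg[of 0] by linarith
  moreover have "norm (x k - P (x k)) \<le> C * \<alpha> k" for k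
    using C[of k] \<alpha>_pos[of k] by (simp add: r_def field_simps)
  ultimately show ?thesis by (rule that)
qed

lemma penalty_bound:
  obtains C where "0 \<le> C" "\<And>k. x k \<bullet> (x k - T (x k)) \<le> C * (\<alpha> k)\<^sup>2"
proof -
  obtain C where C: "0 \<le> C" "\<And>k. norm (x k - P (x k)) \<le> C * \<alpha> k"
    using deviation_bound by blast
  have "x k \<bullet> (x k - T (x k)) \<le> 2 * C\<^sup>2 * (\<alpha> k)\<^sup>2" for k
  proof -
    have "(norm (x k - P (x k)))\<^sup>2 \<le> (C * \<alpha> k)\<^sup>2"
      using C(2) by (intro power_mono) auto
    then show ?thesis
      using quadratic_deviation_bound[of "x k"] by (simp add: power_mult_distrib)
  qed
  then show ?thesis
    using that[of "2 * C\<^sup>2"] by simp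
qed

text \<open>Since \<open>T - I\<close> annihilates \<open>P (x k)\<close>, both parts of the increment are of order \<open>\<alpha> k\<close>.\<close>
lemma step_bound:
  obtains C where "0 \<le> C" "\<And>k. norm (x (Suc k) - x k) \<le> C * \<alpha> k"
proof -
  obtain K where K: "K > 0" "\<And>v. norm (T v) \<le> K * norm v"
    using linear_bounded_pos[OF linear_T] by blast
  obtain C where C: "0 \<le> C" "\<And>k. norm (x k - P (x k)) \<le> C * \<alpha> k"
    using deviation_bound by blast
  have "norm (x (Suc k) - x k) \<le> ((K + 1) * C + B) * \<alpha> k" for k
  proof -
    let ?d = "x k - P (x k)"
    have eq: "x (Suc k) - x k = T ?d - ?d - \<alpha> k *\<^sub>R G (x k)"
      by (simp add: x_Suc T_simps T_P)
    have "norm (x (Suc k) - x k) \<le> norm (T ?d) + norm ?d + \<alpha> k * norm (G (x k))"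
      unfolding eq using norm_triangle_ineq4[of "T ?d - ?d" "\<alpha> k *\<^sub>R G (x k)"] norm_triangle_ineq4[of "T ?d" ?d]
        \<alpha>_pos[of k] by simp
    also have "\<dots> \<le> (K + 1) * norm ?d + \<alpha> k * B"
      using K(2)[of ?d] mult_left_mono[OF G_bounded less_imp_le[OF \<alpha>_pos], of k k]
      by (simp only: distrib_right mult_1)
    also have "\<dots> \<le> (K + 1) * (C * \<alpha> k) + \<alpha> k * B"
      using K(1) C(2) by (intro add_mono mult_left_mono order_refl) auto
    finally show ?thesis
      by (simp add: algebra_simps)
  qed
  then show ?thesis
    using that[of "(K + 1) * C + B"] K C B_nonneg by simp
qed

text \<open>The Lyapunov function at the iterates; for \<open>T X = W ** X\<close> it is \<open>lyapunov\<close>.\<close>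
definition V :: "nat \<Rightarrow> real" where
  "V k = F (x k) + 1 / (2 * \<alpha> k) * (x k \<bullet> (x k - T (x k)))"

lemma V_bounded_below: "c \<le> V k"
  using F_bounded_below[of "x k"] T_le[of "x k"] \<alpha>_pos[of k]
  by (simp add: V_def add_increasing2)

lemma penalty_tendsto_0: "(\<lambda>k. V k - F (x k)) \<longlonglongrightarrow> 0"
proof -
  obtain C where C: "0 \<le> C" "\<And>k. x k \<bullet> (x k - T (x k)) \<le> C * (\<alpha> k)\<^sup>2"
    using penalty_bound by blast
  have "norm (V k - F (x k)) \<le> C / 2 * \<alpha> k" for k
  proof -
    have "1 / (2 * \<alpha> k) * (x k \<bullet> (x k - T (x k))) \<le> 1 / (2 * \<alpha> k) * (C * (\<alpha> k)\<^sup>2)"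
      using \<alpha>_pos[of k] C(2) by (intro mult_left_mono) auto
    also have "\<dots> = C / 2 * \<alpha> k"
      using \<alpha>_pos[of k] by (simp add: power2_eq_square)
    moreover have "0 \<le> 1 / (2 * \<alpha> k) * (x k \<bullet> (x k - T (x k)))"
      using \<alpha>_pos[of k] T_le by (intro mult_nonneg_nonneg) auto
    ultimately show ?thesis
      by (simp add: V_def)
  qed
  moreover have "(\<lambda>k. C / 2 * \<alpha> k) \<longlonglongrightarrow> 0"
    using \<alpha>_tendsto_0 by (rule tendsto_mult_right_zero)
  ultimately show ?thesis
    by (intro Lim_null_comparison[of "\<lambda>k. V k - F (x k)" "\<lambda>k. C / 2 * \<alpha> k"]) auto
qed

text \<open>With \<open>s = x (k + 1) - x k\<close> and \<open>a = \<alpha> k\<close>, insert \<open>a *\<^sub>R G (x k) = T (x k) - x k - s\<close> into the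
  mean value bound for \<open>F\<close>. The mixed terms in \<open>x k\<close> and \<open>s\<close> cancel against those of the quadratic
  form, and what remains is \<open>- (s \<bullet> (s + T s)) / (2 * a) + M * \<parallel>s\<parallel>\<^sup>2\<close>. The first term dominates once
  \<open>a\<close> is small. The correction \<open>D * \<alpha> k\<close> absorbs the change of the penalty weight.\<close>
lemma eventually_V_descent:
  obtains \<mu> D where "0 < \<mu>" "0 \<le> D"
    "eventually (\<lambda>k. V (Suc k) + D * \<alpha> (Suc k)
        \<le> V k + D * \<alpha> k - \<mu> / \<alpha> k * (norm (x (Suc k) - x k))\<^sup>2) sequentially"
proof -
  obtain \<mu> where \<mu>: "0 < \<mu>" "\<And>v. \<mu> * (norm v)\<^sup>2 \<le> v \<bullet> (v + T v)"
    using id_plus_T_bounded_below by blast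
  obtain C where C: "0 \<le> C" "\<And>k. x k \<bullet> (x k - T (x k)) \<le> C * (\<alpha> k)\<^sup>2"
    using penalty_bound by blast
  have "(\<lambda>k. \<alpha> k * M) \<longlonglongrightarrow> 0"
    using \<alpha>_tendsto_0 by (rule tendsto_mult_left_zero)
  then have "eventually (\<lambda>k. \<alpha> k * M < \<mu> / 4) sequentially"
    using \<mu> by (intro order_tendstoD) auto
  then have "eventually (\<lambda>k. V (Suc k) + C / 2 * \<alpha> (Suc k)
        \<le> V k + C / 2 * \<alpha> k - \<mu> / 4 / \<alpha> k * (norm (x (Suc k) - x k))\<^sup>2) sequentially"
  proof eventually_elim
    case (elim k)
    define a where "a = \<alpha> k"
    define a' where "a' = \<alpha> (Suc k)"
    define y where "y = x k"
    define s where "s = x (Suc k) - x k"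
    have a: "0 < a" "0 < a'" "a' \<le> a"
      using \<alpha>_pos \<alpha>_decreasing by (auto simp: a_def a'_def)
    have x': "x (Suc k) = y + s"
      by (simp add: y_def s_def)
    have g: "a *\<^sub>R G y = T y - y - s"
      by (simp add: y_def s_def a_def x_Suc)
    have "F (y + s) \<le> F y + G y \<bullet> s + M * (norm s)\<^sup>2"
      using gradient_mean_value_bound[OF F_gradient G_lipschitz, of "y + s" y] by simp
    then have "2 * a * F (y + s) \<le> 2 * a * (F y + G y \<bullet> s + M * (norm s)\<^sup>2)"
      using a by simp
    also have "\<dots> = 2 * a * F y + 2 * ((a *\<^sub>R G y) \<bullet> s) + 2 * a * M * (norm s)\<^sup>2"
      by (simp add: algebra_simps)
    also have "\<dots> = 2 * a * F y + 2 * (T y \<bullet> s - y \<bullet> s - s \<bullet> s) + 2 * a * M * (norm s)\<^sup>2"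
      by (simp only: g inner_diff_left)
    finally have 1: "2 * a * F (y + s) \<le> \<dots>" .
    have 2: "(y + s) \<bullet> (y + s - T (y + s)) = y \<bullet> (y - T y) + 2 * (y \<bullet> s - T y \<bullet> s)
        + s \<bullet> s - s \<bullet> T s"
      using T_adjoint[of y s] by (simp add: T_simps inner_simps inner_commute)
    have 3: "2 * a * M * (norm s)\<^sup>2 \<le> \<mu> / 2 * (norm s)\<^sup>2"
      using elim by (intro mult_right_mono) (auto simp: a_def)
    have 4: "2 * (\<mu> / 2 * (norm s)\<^sup>2) \<le> s \<bullet> s + s \<bullet> T s"
      using \<mu>(2)[of s] by (simp add: inner_add_right)
    \<comment> \<open>the cancellation, with \<open>t = T y \<bullet> s\<close>, \<open>d = y \<bullet> s\<close>, \<open>e = s \<bullet> s\<close> and \<open>h = s \<bullet> T s\<close>\<close>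
    have "p + q' \<le> r + q - m"
      if "p \<le> r + 2 * (t - d - e) + w" "q' = q + 2 * (d - t) + e - h" "w \<le> m" "2 * m \<le> e + h"
      for p q q' r t d e w m h :: real
      using that by argo
    from this[OF 1 2 3 4] have "2 * a * F (y + s) + (y + s) \<bullet> (y + s - T (y + s))
        \<le> 2 * a * F y + y \<bullet> (y - T y) - \<mu> / 2 * (norm s)\<^sup>2" .
    then have "(2 * a * F (y + s) + (y + s) \<bullet> (y + s - T (y + s))) / (2 * a)
        \<le> (2 * a * F y + y \<bullet> (y - T y) - \<mu> / 2 * (norm s)\<^sup>2) / (2 * a)"
      using a by (intro divide_right_mono) auto
    then have descent: "F (y + s) + 1 / (2 * a) * ((y + s) \<bullet> (y + s - T (y + s)))
        \<le> V k - \<mu> / 4 / a * (norm s)\<^sup>2"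
      using a by (simp add: V_def y_def[symmetric] a_def[symmetric] add_divide_distrib diff_divide_distrib)
    \<comment> \<open>changing the penalty weight from \<open>1 / (2 * a)\<close> to \<open>1 / (2 * a')\<close> costs at most a
      telescoping amount\<close>
    have "(1 / (2 * a') - 1 / (2 * a)) * ((y + s) \<bullet> (y + s - T (y + s)))
        \<le> (1 / (2 * a') - 1 / (2 * a)) * (C * a'\<^sup>2)"
      using a C(2)[of "Suc k"] by (intro mult_left_mono) (auto simp: x' a'_def frac_le)
    also have "\<dots> = C / 2 * ((a - a') * (a' / a))"
      using a by (simp add: field_simps power2_eq_square)
    also have "\<dots> \<le> C / 2 * ((a - a') * 1)"
      using a C(1) by (intro mult_left_mono) auto
    finally have "V (Suc k) \<le> F (y + s) + 1 / (2 * a) * ((y + s) \<bullet> (y + s - T (y + s)))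
        + C / 2 * (a - a')"
      unfolding V_def x' a'_def[symmetric] left_diff_distrib right_diff_distrib mult_1_right
      by linarith
    with descent show ?case
      unfolding a_def[symmetric] a'_def[symmetric] s_def[symmetric] right_diff_distrib
      by linarith
  qed
  then show ?thesis
    using that[of "\<mu> / 4" "C / 2"] \<mu> C by simp
qed

text \<open>\<open>V k + D * \<alpha> k\<close> is eventually decreasing and bounded below; its decreases dominate the terms
  of the series.\<close>
lemma V_convergent_and_steps_summable:
  shows V_convergent: "convergent V"
    and steps_summable: "summable (\<lambda>k. (norm (x (Suc k) - x k))\<^sup>2 / \<alpha> k)"
proof -
  obtain \<mu> D where \<mu>: "0 < \<mu>" "0 \<le> D" and
    ev: "eventually (\<lambda>k. V (Suc k) + D * \<alpha> (Suc k)
        \<le> V k + D * \<alpha> k - \<mu> / \<alpha> k * (norm (x (Suc k) - x k))\<^sup>2) sequentially"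
    using eventually_V_descent by blast
  define U where "U k = V k + D * \<alpha> k" for k
  define q where "q k = (norm (x (Suc k) - x k))\<^sup>2 / \<alpha> k" for k
  have q: "0 \<le> q k" for k
    using \<alpha>_pos[of k] by (simp add: q_def)
  obtain N where N: "\<And>k. k \<ge> N \<Longrightarrow> U (Suc k) \<le> U k - \<mu> * q k"
    using ev by (auto simp: eventually_sequentially U_def q_def)
  have "decseq (\<lambda>k. U (k + N))"
  proof (rule decseq_SucI)
    fix k
    have "0 \<le> \<mu> * q (k + N)"
      using \<mu> q by simp
    then show "U (Suc k + N) \<le> U (k + N)"
      using N[of "k + N"] by simp
  qed
  moreover have "\<forall>k. c \<le> U (k + N)"
    using V_bounded_below \<mu> \<alpha>_pos by (auto simp: U_def less_imp_le intro!: add_increasing2)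
  ultimately obtain l where "(\<lambda>k. U (k + N)) \<longlonglongrightarrow> l"
    using decseq_convergent by blast
  then have U: "U \<longlonglongrightarrow> l"
    by (rule LIMSEQ_offset)
  then have "(\<lambda>k. U k - D * \<alpha> k) \<longlonglongrightarrow> l - D * 0"
    using \<alpha>_tendsto_0 by (intro tendsto_intros)
  then show "convergent V"
    by (auto simp: U_def convergent_def)
  have "summable (\<lambda>k. (U k - U (Suc k)) / \<mu>)"
    using U by (intro summable_divide telescope_summable')
  moreover have "eventually (\<lambda>k. norm (q k) \<le> (U k - U (Suc k)) / \<mu>) sequentially"
    unfolding eventually_sequentially using N \<mu> q by (intro exI[of _ N]) (fastforce simp: field_simps)
  ultimately have "summable q"
    by (rule summable_comparison_test_ev[rotated])
  then show "summable (\<lambda>k. (norm (x (Suc k) - x k))\<^sup>2 / \<alpha> k)"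
    by (simp add: q_def[abs_def])
qed

lemma F_and_V_same_limit: "\<exists>l. V \<longlonglongrightarrow> l \<and> (\<lambda>k. F (x k)) \<longlonglongrightarrow> l"
proof -
  obtain l where l: "V \<longlonglongrightarrow> l"
    using V_convergent by (auto simp: convergent_def)
  then have "(\<lambda>k. V k - (V k - F (x k))) \<longlonglongrightarrow> l - 0"
    using penalty_tendsto_0 by (rule tendsto_diff)
  with l show ?thesis
    by auto
qed

text \<open>\<open>P (x (k + 1) - x k) = - \<alpha> k *\<^sub>R P (G (x k))\<close> turns the summability of
  \<open>\<parallel>x (k + 1) - x k\<parallel>\<^sup>2 / \<alpha> k\<close> into that of \<open>\<alpha> k * \<parallel>P (G (x k))\<parallel>\<^sup>2\<close>; the Lipschitz condition and
  \<open>step_bound\<close> provide the slow variation.\<close>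
lemma projected_gradient_tendsto_0: "(\<lambda>k. P (G (x k))) \<longlonglongrightarrow> 0"
proof -
  obtain K where K: "K > 0" "\<And>v. norm (P v) \<le> K * norm v"
    using linear_bounded_pos[OF linear_P] by blast
  obtain C where C: "0 \<le> C" "\<And>k. norm (x (Suc k) - x k) \<le> C * \<alpha> k"
    using step_bound by blast
  let ?a = "\<lambda>k. norm (P (G (x k)))"
  have "?a \<longlonglongrightarrow> 0"
  proof (rule slowly_varying_tendsto_0[where \<alpha> = \<alpha> and c = 2 and C = "K * (M * C)"])
    show "0 \<le> ?a k" "0 < \<alpha> k" for k
      using \<alpha>_pos by auto
    show "eventually (\<lambda>k. \<alpha> k \<le> 2 * \<alpha> (Suc k)) sequentially"
      using \<alpha>_ratio_le_2 by eventually_elim (use \<alpha>_pos in \<open>simp add: field_simps\<close>)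
    show "\<not> summable \<alpha>"
      by (rule \<alpha>_not_summable)
    show "summable (\<lambda>k. \<alpha> k * (?a k)\<^sup>2)"
    proof (rule summable_comparison_test')
      show "summable (\<lambda>k. K\<^sup>2 * ((norm (x (Suc k) - x k))\<^sup>2 / \<alpha> k))"
        by (intro summable_mult steps_summable)
      fix k :: nat
      have "P (x (Suc k) - x k) = - (\<alpha> k *\<^sub>R P (G (x k)))"
        by (simp add: x_Suc P_simps P_T)
      then have "\<alpha> k * ?a k = norm (P (x (Suc k) - x k))"
        using \<alpha>_pos[of k] by simp
      also have "\<dots> \<le> K * norm (x (Suc k) - x k)"
        by (rule K)
      finally have "(\<alpha> k * ?a k)\<^sup>2 \<le> (K * norm (x (Suc k) - x k))\<^sup>2"
        using \<alpha>_pos[of k] by (intro power_mono) auto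
      then have "(\<alpha> k * ?a k)\<^sup>2 / \<alpha> k \<le> (K * norm (x (Suc k) - x k))\<^sup>2 / \<alpha> k"
        using \<alpha>_pos[of k] by (intro divide_right_mono) auto
      moreover have "(\<alpha> k * ?a k)\<^sup>2 / \<alpha> k = norm (\<alpha> k * (?a k)\<^sup>2)"
        using \<alpha>_pos[of k] by (simp add: power2_eq_square)
      ultimately show "norm (\<alpha> k * (?a k)\<^sup>2) \<le> K\<^sup>2 * ((norm (x (Suc k) - x k))\<^sup>2 / \<alpha> k)"
        by (simp add: power_mult_distrib)
    qed
    show "\<bar>?a (Suc k) - ?a k\<bar> \<le> K * (M * C) * \<alpha> k" for k
    proof -
      have "\<bar>?a (Suc k) - ?a k\<bar> \<le> norm (P (G (x (Suc k)) - G (x k)))"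
        unfolding P_simps by (rule norm_triangle_ineq3)
      also have "\<dots> \<le> K * norm (G (x (Suc k)) - G (x k))"
        by (rule K)
      also have "\<dots> \<le> K * (M * norm (x (Suc k) - x k))"
        using lipschitz_onD[OF G_lipschitz, of "x (Suc k)" "x k"] K(1)
        by (intro mult_left_mono) (auto simp: dist_norm)
      also have "\<dots> \<le> K * (M * (C * \<alpha> k))"
        using K(1) M_nonneg C(2) by (intro mult_left_mono) auto
      finally show ?thesis
        by (simp add: mult.assoc)
    qed
  qed
  then show ?thesis
    by (simp add: tendsto_norm_zero_iff)
qed

lemma limit_point_stationary:
  assumes "z \<in> seq_limit_points x"
  shows "P z = z" and "P (G z) = 0"
proof -
  obtain r where r: "strict_mono r" "(x \<circ> r) \<longlonglongrightarrow> z"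
    using assms by (auto simp: seq_limit_points_def)
  then have xr: "(\<lambda>k. x (r k)) \<longlonglongrightarrow> z"
    by (simp add: o_def)
  obtain C where C: "0 \<le> C" "\<And>k. norm (x k - P (x k)) \<le> C * \<alpha> k"
    using deviation_bound by blast
  have "(\<lambda>k. C * \<alpha> k) \<longlonglongrightarrow> 0"
    using \<alpha>_tendsto_0 by (rule tendsto_mult_right_zero)
  then have "(\<lambda>k. x k - P (x k)) \<longlonglongrightarrow> 0"
    using C(2) by (intro Lim_null_comparison[of "\<lambda>k. x k - P (x k)" "\<lambda>k. C * \<alpha> k"]) auto
  then have "(\<lambda>k. x (r k) - P (x (r k))) \<longlonglongrightarrow> 0"
    using LIMSEQ_subseq_LIMSEQ[OF _ r(1)] by (fastforce simp: o_def)
  moreover have P_cont: "continuous_on UNIV P"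
    by (rule continuous_on_P) (rule continuous_on_id)
  then have "(\<lambda>k. x (r k) - P (x (r k))) \<longlonglongrightarrow> z - P z"
    using xr by (intro tendsto_diff continuous_on_tendsto_compose[of UNIV P]) auto
  ultimately have "z - P z = 0"
    by (rule LIMSEQ_unique[rotated])
  then show "P z = z"
    by simp
  have "continuous_on UNIV G"
    using G_lipschitz by (rule lipschitz_on_continuous_on)
  then have "(\<lambda>k. P (G (x (r k)))) \<longlonglongrightarrow> P (G z)"
    using xr by (intro continuous_on_tendsto_compose[of UNIV "\<lambda>v. P (G v)"] continuous_on_P) auto
  moreover have "(\<lambda>k. P (G (x (r k)))) \<longlonglongrightarrow> 0"
    using LIMSEQ_subseq_LIMSEQ[OF projected_gradient_tendsto_0 r(1)] by (simp add: o_def)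
  ultimately show "P (G z) = 0"
    by (rule LIMSEQ_unique)
qed

lemma steps_tendsto_0: "(\<lambda>k. dist (x (Suc k)) (x k)) \<longlonglongrightarrow> 0"
proof -
  obtain C where C: "0 \<le> C" "\<And>k. norm (x (Suc k) - x k) \<le> C * \<alpha> k"
    using step_bound by blast
  have "(\<lambda>k. C * \<alpha> k) \<longlonglongrightarrow> 0"
    using \<alpha>_tendsto_0 by (rule tendsto_mult_right_zero)
  then show ?thesis
    using C(2) by (intro Lim_null_comparison[of "\<lambda>k. dist (x (Suc k)) (x k)" "\<lambda>k. C * \<alpha> k"])
      (auto simp: dist_norm)
qed

end


section \<open>Mixing matrices as averaging operators\<close>
lemma row_of_matrix_mult:
  fixes X :: "real^'p^'n"
  shows "(W ** X) $ i = (\<Sum>k\<in>UNIV. W $ i $ k *\<^sub>R X $ k)"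
  by (simp add: vec_eq_iff matrix_matrix_mult_def)

lemma column_of_matrix_mult:
  fixes X :: "real^'p^'n"
  shows "column j (W ** X) = W *v column j X"
  by (simp add: vec_eq_iff matrix_matrix_mult_def matrix_vector_mult_def column_def)

lemma column_add: "column j (X + Y) = column j X + column j Y"
  and column_diff: "column j (X - Y) = column j X - column j Y"
  for X Y :: "real^'p^'n"
  by (simp_all add: column_def vec_eq_iff)

lemma inner_eq_sum_columns:
  fixes X Y :: "real^'p^'n::finite"
  shows "X \<bullet> Y = (\<Sum>j\<in>UNIV. column j X \<bullet> column j Y)"
  unfolding inner_vec_def column_def by (subst sum.swap) simp

definition row_average :: "real^'p^'n::finite \<Rightarrow> real^'p^'n" where
  "row_average X = (\<chi> i. (1 / real CARD('n)) *\<^sub>R (\<Sum>k\<in>UNIV. X $ k))"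

lemma sum_rows_eq: "(\<Sum>k\<in>UNIV. X $ k) = real CARD('n) *\<^sub>R row_average X $ i"
  for X :: "real^'p^'n::finite"
  by (simp add: row_average_def)

lemma row_average_eq_self_iff: "row_average X = X \<longleftrightarrow> (\<forall>i j. X $ i = X $ j)"
  for X :: "real^'p^'n::finite"
proof
  assume "row_average X = X"
  then have "X $ i = (1 / real CARD('n)) *\<^sub>R (\<Sum>k\<in>UNIV. X $ k)" for i
    by (metis row_average_def vec_lambda_beta)
  then show "\<forall>i j. X $ i = X $ j"
    by metis
next
  assume eq: "\<forall>i j. X $ i = X $ j"
  have "row_average X $ i = X $ i" for i
  proof -
    have "(\<Sum>k\<in>UNIV. X $ k) = (\<Sum>k\<in>(UNIV::'n set). X $ i)"
      using eq by (intro sum.cong) auto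
    also have "\<dots> = real CARD('n) *\<^sub>R X $ i"
      by (rule sum_constant_scaleR)
    finally show ?thesis
      by (simp add: row_average_def)
  qed
  then show "row_average X = X"
    by (simp add: vec_eq_iff)
qed

text \<open>\<open>W ** X\<close> acts on each column of \<open>X\<close> separately and the Frobenius product is the sum of the
  column products, so the properties of \<open>W\<close> on vectors carry over column by column. A fixed column
  is constant, hence all rows of a fixed matrix agree.\<close>
lemma mixing_matrix_averaging_operator:
  fixes W :: "real^'n::finite^'n"
  assumes "mixing_matrix E W"
  shows "averaging_operator (\<lambda>X :: real^'p^'n. W ** X) row_average"
proof (rule averaging_operator.intro)
  have sym: "transpose W = W"
    and ker: "{v. (mat 1 - W) *v v = 0} = span {\<chi> i. 1}"
    and le: "\<And>v. 0 \<le> v \<bullet> ((mat 1 - W) *v v)"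
    and gt: "\<And>v. v \<noteq> 0 \<Longrightarrow> 0 < v \<bullet> ((W - - mat 1) *v v)"
    using assms by (auto simp: mixing_matrix_def loewner_le_def loewner_less_def
        pos_semidefinite_def pos_definite_def)
  have id_minus: "(mat 1 - W) *v v = v - W *v v" for v
    by (simp add: matrix_vector_mult_diff_rdistrib)
  have id_plus: "(W - - mat 1) *v v = v + W *v v" for v
    by (simp add: matrix_vector_mult_add_rdistrib add.commute)
  have adj: "u \<bullet> (W *v v) = (W *v u) \<bullet> v" for u v
    using dot_lmul_matrix[of u W v] transpose_matrix_vector[of W u] by (simp add: sym)
  have fixed: "W *v v = v \<longleftrightarrow> (\<exists>c. v = c *\<^sub>R (\<chi> i. 1))" for v
  proof -
    have "W *v v = v \<longleftrightarrow> v \<in> {v. (mat 1 - W) *v v = 0}"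
      by (auto simp: id_minus)
    then show ?thesis
      unfolding ker by (auto simp: span_singleton)
  qed
  have average: "X \<bullet> row_average Y = (1 / real CARD('n)) * ((\<Sum>k\<in>UNIV. X $ k) \<bullet> (\<Sum>k\<in>UNIV. Y $ k))"
    for X Y :: "real^'p^'n"
  proof -
    have "X \<bullet> row_average Y = (\<Sum>i\<in>UNIV. X $ i \<bullet> ((1 / real CARD('n)) *\<^sub>R (\<Sum>k\<in>UNIV. Y $ k)))"
      by (simp only: inner_vec_def[of X] row_average_def vec_lambda_beta)
    also have "\<dots> = (\<Sum>k\<in>UNIV. X $ k) \<bullet> ((1 / real CARD('n)) *\<^sub>R (\<Sum>k\<in>UNIV. Y $ k))"
      by (rule inner_sum_left[symmetric])
    finally show ?thesis
      by simp
  qed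
  fix X Y :: "real^'p^'n"
  show "linear (\<lambda>X :: real^'p^'n. W ** X)"
    by (rule linearI)
      (simp_all add: vec_eq_iff matrix_matrix_mult_def sum_distrib_left sum.distrib algebra_simps)
  show "linear (row_average :: real^'p^'n \<Rightarrow> _)"
    by (rule linearI)
      (simp_all add: vec_eq_iff row_average_def sum_distrib_left sum.distrib algebra_simps
        flip: scaleR_sum_right)
  show "X \<bullet> (W ** Y) = (W ** X) \<bullet> Y"
    by (simp add: inner_eq_sum_columns column_of_matrix_mult adj)
  show "X \<bullet> row_average Y = row_average X \<bullet> Y"
    using average[of X Y] average[of Y X] by (simp add: inner_commute)
  show "0 \<le> X \<bullet> (X - W ** X)"
    using le by (simp add: inner_eq_sum_columns column_diff column_of_matrix_mult id_minus sum_nonneg)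
  show "0 < X \<bullet> (X + W ** X)" if "X \<noteq> 0"
  proof -
    have nonneg: "0 \<le> v \<bullet> (v + W *v v)" for v
      using gt[of v] unfolding id_plus by (cases "v = 0") auto
    have "\<exists>j. column j X \<noteq> 0"
      using that by (auto simp: vec_eq_iff column_def)
    then obtain j where "column j X \<noteq> 0" ..
    from gt[OF this] have "0 < column j X \<bullet> (column j X + W *v column j X)"
      unfolding id_plus .
    then show ?thesis
      unfolding inner_eq_sum_columns column_add column_of_matrix_mult
      using nonneg by (intro sum_pos2[of UNIV j]) auto
  qed
  show "W ** row_average X = row_average X"
  proof -
    have "W *v (\<chi> i. 1) = (\<chi> i. 1)"
      by (subst fixed) (rule exI[of _ 1], simp)
    then have "(\<Sum>k\<in>UNIV. W $ i $ k) = 1" for i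
      by (simp add: vec_eq_iff matrix_vector_mult_def)
    then show ?thesis
      by (simp add: vec_eq_iff row_of_matrix_mult row_average_def flip: sum_distrib_right sum_divide_distrib)
  qed
  show "row_average X = X" if "W ** X = X"
  proof -
    have "X $ i $ j = X $ k $ j" for i k j
    proof -
      have "W *v column j X = column j X"
        by (metis column_of_matrix_mult that)
      then obtain c where "column j X = c *\<^sub>R (\<chi> i. 1)"
        using fixed by auto
      then show ?thesis
        by (simp add: column_def vec_eq_iff)
    qed
    then show ?thesis
      unfolding row_average_eq_self_iff by (metis vec_eq_iff)
  qed
qed

lemma weighted_norm_sq_id_minus: "weighted_norm_sq (mat 1 - W) X = X \<bullet> (X - W ** X)"
  for X :: "real^'p^'n::finite"
proof -
  have "(mat 1 - W) ** X = mat 1 ** X - W ** X"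
    by (simp add: vec_eq_iff matrix_matrix_mult_def sum_subtractf algebra_simps)
  then show ?thesis
    by (simp add: weighted_norm_sq_def)
qed

section \<open>The stacked objective\<close>
lemma GDERIV_total_obj:
  fixes f :: "'n::finite \<Rightarrow> real^'p \<Rightarrow> real"
  assumes "\<And>i u. f i differentiable (at u)"
  shows "GDERIV (total_obj f) X :> stacked_grad f X"
proof -
  have "((\<lambda>X. f i (X $ i)) has_derivative (\<lambda>H. H $ i \<bullet> gradient (f i) (X $ i))) (at X)" for i
  proof (rule has_derivative_compose[where g = "f i"])
    show "((\<lambda>X. X $ i) has_derivative (\<lambda>H. H $ i)) (at X)"
      by (rule bounded_linear_imp_has_derivative) (rule bounded_linear_vec_nth)
    show "(f i has_derivative (\<lambda>h. h \<bullet> gradient (f i) (X $ i))) (at (X $ i))"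
      using GDERIV_gradient[OF assms] by (simp add: gderiv_def)
  qed
  then have "((\<lambda>X. \<Sum>i\<in>UNIV. f i (X $ i)) has_derivative
      (\<lambda>H. \<Sum>i\<in>UNIV. H $ i \<bullet> gradient (f i) (X $ i))) (at X)"
    by (intro has_derivative_sum)
  then show ?thesis
    by (simp add: gderiv_def total_obj_def[abs_def] stacked_grad_def inner_vec_def)
qed

lemma lipschitz_on_stacked_grad:
  fixes f :: "'n::finite \<Rightarrow> real^'p \<Rightarrow> real"
  assumes "\<And>i. (Lf i)-lipschitz_on UNIV (gradient (f i))"
  shows "(Max (range Lf))-lipschitz_on UNIV (stacked_grad f)"
proof (rule lipschitz_onI)
  have le: "Lf i \<le> Max (range Lf)" for i
    by (intro Max_ge) auto
  show nonneg: "0 \<le> Max (range Lf)"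
    using le[of undefined] lipschitz_on_nonneg[OF assms, of undefined] by linarith
  fix X Y :: "real^'p^'n"
  have "dist (gradient (f i) (X $ i)) (gradient (f i) (Y $ i)) \<le> Max (range Lf) * dist (X $ i) (Y $ i)" for i
    using lipschitz_onD[OF assms, of "X $ i" "Y $ i"] mult_right_mono[OF le, of "dist (X $ i) (Y $ i)"]
    by (meson UNIV_I order_trans zero_le_dist)
  then have "L2_set (\<lambda>i. dist (gradient (f i) (X $ i)) (gradient (f i) (Y $ i))) UNIV
      \<le> L2_set (\<lambda>i. Max (range Lf) * dist (X $ i) (Y $ i)) UNIV"
    by (rule L2_set_mono) (rule zero_le_dist)
  also have "\<dots> = Max (range Lf) * dist X Y"
    by (simp only: dist_vec_def[of X] L2_set_right_distrib[OF nonneg])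
  finally show "dist (stacked_grad f X) (stacked_grad f Y) \<le> Max (range Lf) * dist X Y"
    unfolding dist_vec_def[of "stacked_grad f X"] by (simp only: stacked_grad_def vec_lambda_beta)
qed

lemma total_obj_bounded_below:
  fixes f :: "'n::finite \<Rightarrow> real^'p \<Rightarrow> real"
  assumes "\<And>i. coercive (f i)" "\<And>i u. f i differentiable (at u)"
  obtains c where "\<And>X. c \<le> total_obj f X"
proof -
  have "\<exists>c. \<forall>u. c \<le> f i u" for i
  proof -
    have "continuous_on UNIV (f i)"
      using assms(2) by (intro differentiable_imp_continuous_on)
        (simp add: differentiable_on_def)
    with assms(1) show ?thesis
      using coercive_bounded_below by blast
  qed
  then obtain c where "\<And>i u. c i \<le> f i u"
    by metis
  then have "(\<Sum>i\<in>UNIV. c i) \<le> total_obj f X" for X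
    unfolding total_obj_def by (intro sum_mono)
  then show ?thesis by (rule that)
qed

section \<open>Polynomially decaying steps\<close>

text \<open>The condition \<open>\<epsilon> \<le> 1\<close> makes the series dominate the harmonic series up to a factor.\<close>
lemma powr_steps:
  fixes L \<epsilon> :: real
  assumes L: "0 < L" and eps: "0 < \<epsilon>" "\<epsilon> \<le> 1"
    and step: "\<And>k. \<alpha> k = 1 / (L * (real k + 1) powr \<epsilon>)"
  shows powr_steps_pos: "0 < \<alpha> k"
    and powr_steps_decreasing: "\<alpha> (Suc k) \<le> \<alpha> k"
    and powr_steps_tendsto_0: "\<alpha> \<longlonglongrightarrow> 0"
    and powr_steps_ratio: "(\<lambda>k. \<alpha> k / \<alpha> (Suc k)) \<longlonglongrightarrow> 1"
    and powr_steps_not_summable: "\<not> summable \<alpha>"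
proof -
  have shift: "filterlim (\<lambda>k. real k + 1) at_top sequentially"
    using filterlim_compose[OF filterlim_real_sequentially filterlim_Suc] by (simp add: add.commute)
  show "0 < \<alpha> k" for k
    using L by (simp add: step)
  show "\<alpha> (Suc k) \<le> \<alpha> k"
    unfolding step using L eps by (intro divide_left_mono mult_left_mono powr_mono2) auto
  have "(\<lambda>k. 1 / L * (real k + 1) powr - \<epsilon>) \<longlonglongrightarrow> 1 / L * 0"
    using eps by (intro tendsto_mult tendsto_const tendsto_neg_powr shift) auto
  then show "\<alpha> \<longlonglongrightarrow> 0"
    by (simp add: step[abs_def] powr_minus_divide)
  have "\<alpha> k / \<alpha> (Suc k) = (1 + 1 / (real k + 1)) powr \<epsilon>" for k
  proof -
    have "\<alpha> k / \<alpha> (Suc k) = ((real k + 2) / (real k + 1)) powr \<epsilon>"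
      using L by (simp add: step powr_divide add.commute)
    also have "(real k + 2) / (real k + 1) = 1 + 1 / (real k + 1)"
      by (simp add: field_simps)
    finally show ?thesis .
  qed
  moreover have "(\<lambda>k. (1 + 1 / (real k + 1)) powr \<epsilon>) \<longlonglongrightarrow> (1 + 0) powr \<epsilon>"
    by (intro tendsto_intros real_tendsto_divide_at_top[OF tendsto_const shift]) auto
  ultimately show "(\<lambda>k. \<alpha> k / \<alpha> (Suc k)) \<longlonglongrightarrow> 1"
    by simp
  show "\<not> summable \<alpha>"
  proof
    assume "summable \<alpha>"
    then have sum: "summable (\<lambda>k. L * \<alpha> k)"
      by (rule summable_mult)
    have le: "norm (inverse (real (Suc k))) \<le> L * \<alpha> k" for k
    proof -
      have "(real k + 1) powr \<epsilon> \<le> (real k + 1) powr 1"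
        using eps by (intro powr_mono) auto
      then show ?thesis
        using L by (simp add: step field_simps)
    qed
    from sum have "summable (\<lambda>k. inverse (real (Suc k)))"
      by (rule summable_comparison_test') (rule le)
    then have "summable (\<lambda>k. inverse (real k))"
      by (subst (asm) summable_Suc_iff)
    then show False
      using not_summable_harmonic[where 'a = real] by simp
  qed
qed

section \<open>Decentralized gradient descent\<close>
theorem theorem2:
  fixes E :: "('n::finite \<times> 'n) set"
    and W :: "real^'n^'n"
    and f :: "'n \<Rightarrow> real^'p \<Rightarrow> real"
    and Lf :: "'n \<Rightarrow> real"
    and L \<epsilon> B :: real
    and \<alpha> :: "nat \<Rightarrow> real"
    and x :: "nat \<Rightarrow> real^'p^'n"
  assumes graph: "connected_undirected_graph E"
    and mixing: "mixing_matrix E W"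
    and coercive: "\<And>i. coercive (f i)"
    and differentiable: "\<And>i u. f i differentiable (at u)"
    and Lf_pos: "\<And>i. Lf i > 0"
    and lipschitz: "\<And>i. (Lf i)-lipschitz_on UNIV (gradient (f i))"
    and L: "L = Max (range Lf)"
    and eps: "0 < \<epsilon>" "\<epsilon> \<le> 1"
    and step: "\<And>k. \<alpha> k = 1 / (L * (real k + 1) powr \<epsilon>)"
    and dgd: "\<And>k. x (Suc k) = W ** x k - \<alpha> k *\<^sub>R stacked_grad f (x k)"
    and B_pos: "B > 0"
    and bounded: "\<And>k. norm (stacked_grad f (x k)) \<le> B"
  shows "(\<exists>l. (\<lambda>k. lyapunov W f (\<alpha> k) (x k)) \<longlonglongrightarrow> l \<and> (\<lambda>k. total_obj f (x k)) \<longlonglongrightarrow> l)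
    \<and> ((\<lambda>k. \<Sum>i\<in>UNIV. stacked_grad f (x k) $ i) \<longlonglongrightarrow> 0
         \<and> (\<forall>z \<in> seq_limit_points x. consensus_stationary f z))
    \<and> ((\<exists>z. z isolated_in seq_limit_points x) \<longrightarrow> convergent x)"
proof -
  have "0 < L"
    unfolding L using Lf_pos by (subst Max_gr_iff) auto
  note steps = powr_steps[OF this eps step]
  have lip: "L-lipschitz_on UNIV (stacked_grad f)"
    unfolding L using lipschitz by (rule lipschitz_on_stacked_grad)
  obtain c where c: "\<And>X. c \<le> total_obj f X"
    using total_obj_bounded_below coercive differentiable by blast
  interpret averaging_operator "\<lambda>X :: real^'p^'n. W ** X" row_average
    using mixing by (rule mixing_matrix_averaging_operator)
  interpret averaged_gradient_descent "\<lambda>X :: real^'p^'n. W ** X" row_average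
    "total_obj f" "stacked_grad f" L B c \<alpha> x
    by unfold_locales (rule GDERIV_total_obj differentiable lip c steps dgd bounded)+
  have V: "V k = lyapunov W f (\<alpha> k) (x k)" for k
    by (simp add: V_def lyapunov_def weighted_norm_sq_id_minus)
  show ?thesis
  proof (intro conjI ballI impI)
    show "\<exists>l. (\<lambda>k. lyapunov W f (\<alpha> k) (x k)) \<longlonglongrightarrow> l \<and> (\<lambda>k. total_obj f (x k)) \<longlonglongrightarrow> l"
      using F_and_V_same_limit by (simp add: V[abs_def])
    \<comment> \<open>all rows of the average agree, so any index serves to read off the column sums\<close>
    have "(\<lambda>k. real CARD('n) *\<^sub>R row_average (stacked_grad f (x k)) $ undefined)
        \<longlonglongrightarrow> real CARD('n) *\<^sub>R (0 :: real^'p^'n) $ undefined"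
      using projected_gradient_tendsto_0 by (intro tendsto_scaleR tendsto_const tendsto_vec_nth)
    then show "(\<lambda>k. \<Sum>i\<in>UNIV. stacked_grad f (x k) $ i) \<longlonglongrightarrow> 0"
      by (simp flip: sum_rows_eq)
    show "consensus_stationary f z" if "z \<in> seq_limit_points x" for z
      using limit_point_stationary[OF that] sum_rows_eq[of "stacked_grad f z" undefined]
      by (simp add: consensus_stationary_def row_average_eq_self_iff)
    show "convergent x" if "\<exists>z. z isolated_in seq_limit_points x"
      using that isolated_limit_point_imp_convergent[OF steps_tendsto_0]
      by (auto simp: convergent_def)
  qed
qed

end
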